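(* There exist infinitely many pairwise non-isomorphic finite non-RCC-groups, and the smallest order of a finite non-RCC-group is $120$.
   Context: A permutation of a finite set satisfies the regular cycle condition (RCC) if it has a cycle whose length equals its order. A finite group is an RCC-group if every automorphism of it, viewed as a permutation of its underlying set, satisfies the RCC; otherwise it is a non-RCC-group. *)

theory Defs
  imports
    "HOL-Algebra.Bij"
    "HOL-Algebra.Multiplicative_Group"
    "HOL-Combinatorics.Orbits"
begin

text \<open>
  Permutations of a set \<open>S\<close> are the elements of \<^const>\<open>Bij\<close> \<open>S\<close>, and the order of a permutation is
  its order in the group \<^const>\<open>BijGroup\<close> \<open>S\<close>. The cycles of a permutation of a finite set are its
  orbits (fixed points count as cycles of length 1), and the length of a cycle is the cardinality
  of the orbit. The functional orbit of \<open>HOL-Combinatorics\<close> is meant, not the orbit of a group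
  action from \<open>HOL-Algebra\<close>.
\<close>

definition regular_cycle_condition :: "'a set \<Rightarrow> ('a \<Rightarrow> 'a) \<Rightarrow> bool" where
  "regular_cycle_condition S f \<longleftrightarrow>
     (\<exists>x\<in>S. card (Orbits.orbit f x) = group.ord (BijGroup S) f)"

definition finite_RCC_group :: "('a, 'b) monoid_scheme \<Rightarrow> bool" where
  "finite_RCC_group G \<longleftrightarrow>
     group G \<and> finite (carrier G) \<and> (\<forall>f\<in>auto G. regular_cycle_condition (carrier G) f)"

definition finite_non_RCC_group :: "('a, 'b) monoid_scheme \<Rightarrow> bool" where
  "finite_non_RCC_group G \<longleftrightarrow>
     group G \<and> finite (carrier G) \<and> \<not> finite_RCC_group G"

end

theory Submission
  imports Defs "HOL-Algebra.Elementary_Groups" "HOL-Algebra.Weak_Morphisms"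
    "HOL-Library.Countable" "HOL-Computational_Algebra.Primes"
begin

text \<open>
  If no cycle of an automorphism \<open>f\<close> of \<open>G\<close> has length \<open>n = ord f\<close>, then every \<open>x\<close> is fixed by some
  \<open>f ^ (n / p)\<close> with \<open>p\<close> a prime divisor of \<open>n\<close>, so the fixed subgroups \<open>F p\<close> of these powers cover
  \<open>G\<close>. Pick an irredundant subcover, indexed by a set \<open>J\<close> of primes; for each \<open>j \<in> J\<close> an element lying
  in \<open>F j\<close> only has a cycle length divisible by the product of \<open>J - {j}\<close>. No group is the union of two
  proper subgroups, so \<open>J\<close> has at least three elements. If it has four, two such cycles have lengths
  at least \<open>3 * 5 * 7\<close> and \<open>2 * 3 * 5\<close>. If \<open>J = {p, q, r}\<close>, the intersection \<open>D\<close> of the three subgroups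
  has index 4; for \<open>t \<notin> F p\<close> the element \<open>t\<inverse> * (f ^ (n / p)) t\<close> lies in \<open>D\<close> and has order \<open>p\<close>,
  and likewise for \<open>q\<close> and \<open>r\<close>, so \<open>p * q * r \<ge> 30\<close> divides the order of \<open>D\<close>.

  Equality holds for the product of the dihedral groups of orders 6 and 10 with the cyclic group
  of order 2, and further cyclic factors give infinitely many examples.
\<close>

subsection \<open>Cycle lengths and orders of permutations\<close>

text \<open>Members of \<open>Bij S\<close> are \<open>undefined\<close> off \<open>S\<close>, while
  \<open>f ^^ 0\<close> is the identity everywhere; hence the restriction.\<close>

lemma nat_pow_BijGroup:
  assumes "f \<in> Bij S"
  shows "f [^]\<^bsub>BijGroup S\<^esub> (k::nat) = restrict (f ^^ k) S"
proof (induction k)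
  case 0
  show ?case by (auto simp: BijGroup_def)
next
  case (Suc k)
  interpret group "BijGroup S" by (rule group_BijGroup)
  have mult: "g \<otimes>\<^bsub>BijGroup S\<^esub> f = compose S g f" if "g \<in> Bij S" for g
    using that assms by (simp add: BijGroup_def)
  have carrier: "carrier (BijGroup S) = Bij S" by (simp add: BijGroup_def)
  have "f [^]\<^bsub>BijGroup S\<^esub> k \<in> Bij S"
    using assms nat_pow_closed unfolding carrier by blast
  then have "f [^]\<^bsub>BijGroup S\<^esub> Suc k = compose S (f [^]\<^bsub>BijGroup S\<^esub> k) f"
    by (simp add: mult)
  also have "\<dots> = restrict (f ^^ Suc k) S"
    unfolding compose_def Suc
  proof (rule restrict_ext)
    fix x assume "x \<in> S"
    then have "f x \<in> S" using Bij_imp_funcset[OF assms] by (rule funcset_mem[rotated])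
    then show "restrict (f ^^ k) S (f x) = (f ^^ Suc k) x"
      by (simp only: restrict_apply if_True funpow_Suc_right comp_apply)
  qed
  finally show ?case .
qed

lemma ord_BijGroup_dvd_iff:
  assumes "f \<in> Bij S"
  shows "group.ord (BijGroup S) f dvd k \<longleftrightarrow> (\<forall>x\<in>S. (f ^^ k) x = x)"
proof -
  interpret group "BijGroup S" by (rule group_BijGroup)
  have "f \<in> carrier (BijGroup S)" using assms by (simp add: BijGroup_def)
  then have "ord f dvd k \<longleftrightarrow> f [^]\<^bsub>BijGroup S\<^esub> k = \<one>\<^bsub>BijGroup S\<^esub>"
    by (simp add: pow_eq_id)
  also have "\<dots> \<longleftrightarrow> restrict (f ^^ k) S = (\<lambda>x\<in>S. x)"
    by (simp add: nat_pow_BijGroup[OF assms]) (simp add: BijGroup_def)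
  also have "\<dots> \<longleftrightarrow> (\<forall>x\<in>S. (f ^^ k) x = x)"
    by (metis restrict_apply' restrict_ext)
  finally show ?thesis .
qed

lemma ord_BijGroup_pos:
  assumes "f \<in> Bij S" "finite S"
  shows "0 < group.ord (BijGroup S) f"
proof -
  interpret group "BijGroup S" by (rule group_BijGroup)
  have "Bij S \<subseteq> S \<rightarrow>\<^sub>E S"
    by (auto simp: Bij_def bij_betw_def PiE_def)
  then have "finite (carrier (BijGroup S))"
    using assms(2) by (auto simp: BijGroup_def intro: finite_subset finite_PiE)
  moreover have "f \<in> carrier (BijGroup S)" using assms by (simp add: BijGroup_def)
  ultimately have "1 \<le> ord f" by (rule ord_ge_1)
  then show ?thesis by simp
qed

text \<open>\<open>funpow_dist1 f x x\<close> is the first positive time at which \<open>x\<close>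
  returns, so the return times are exactly its multiples.\<close>

lemma card_orbit_dvd_iff:
  assumes "x \<in> Orbits.orbit f x"
  shows "card (Orbits.orbit f x) dvd k \<longleftrightarrow> (f ^^ k) x = x"
proof -
  let ?m = "funpow_dist1 f x x"
  have card: "card (Orbits.orbit f x) = ?m"
    using card_image[OF inj_on_funpow_dist1[OF assms]] orbit_conv_funpow_dist1[OF assms] by simp
  have fix_m: "(f ^^ ?m) x = x" by (rule funpow_dist1_prop[OF assms])
  have "(f ^^ (k mod ?m)) x = x \<longleftrightarrow> k mod ?m = 0"
    using funpow_dist1_least[of "k mod ?m" f x x] by (cases "k mod ?m = 0") auto
  then show ?thesis
    using card funpow_mod_eq[OF fix_m, of k] by (simp add: dvd_eq_mod_eq_0)
qed

text \<open>\<open>Orbits.orbit\<close> collects only iterates with positive exponent, so a positive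
  return time must be exhibited; the order of \<open>f\<close> is one.\<close>

lemma self_in_orbit_Bij:
  assumes "f \<in> Bij S" "finite S" "x \<in> S"
  shows "x \<in> Orbits.orbit f x"
proof -
  let ?n = "group.ord (BijGroup S) f"
  have "(f ^^ ?n) x = x" using ord_BijGroup_dvd_iff[OF assms(1), of ?n] assms(3) by simp
  then show ?thesis
    using ord_BijGroup_pos[OF assms(1,2)] by (auto simp: orbit_altdef intro!: exI[of _ ?n])
qed

text \<open>Removes orders and orbits from the condition, so that explicit examples and transport
  along isomorphisms need only return times. A cycle length always divides the order; equality is
  therefore the converse divisibility, tested on multiples.\<close>

lemma regular_cycle_condition_iff:
  assumes "f \<in> Bij S" "finite S"
  shows "regular_cycle_condition S f \<longleftrightarrow>
    (\<exists>x\<in>S. \<forall>k. (f ^^ k) x = x \<longrightarrow> (\<forall>y\<in>S. (f ^^ k) y = y))"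
proof -
  let ?n = "group.ord (BijGroup S) f"
  have "card (Orbits.orbit f x) = ?n \<longleftrightarrow>
      (\<forall>k. (f ^^ k) x = x \<longrightarrow> (\<forall>y\<in>S. (f ^^ k) y = y))" if x: "x \<in> S" for x
  proof -
    note orb = card_orbit_dvd_iff[OF self_in_orbit_Bij[OF assms x]]
    note ord = ord_BijGroup_dvd_iff[OF assms(1)]
    have "card (Orbits.orbit f x) dvd ?n" unfolding orb using iffD1[OF ord dvd_refl] x by blast
    then have "card (Orbits.orbit f x) = ?n \<longleftrightarrow> ?n dvd card (Orbits.orbit f x)"
      using dvd_antisym by auto
    also have "\<dots> \<longleftrightarrow> (\<forall>k. card (Orbits.orbit f x) dvd k \<longrightarrow> ?n dvd k)"
      by (meson dvd_trans dvd_refl)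
    finally show ?thesis by (simp only: orb ord)
  qed
  then show ?thesis unfolding regular_cycle_condition_def by blast
qed

subsection \<open>Irredundant covers by subgroups\<close>

lemma irredundant_subcover:
  assumes "finite I" "S \<subseteq> (\<Union>i\<in>I. F i)"
  obtains J where "J \<subseteq> I" "S \<subseteq> (\<Union>i\<in>J. F i)"
    "\<And>j. j \<in> J \<Longrightarrow> \<exists>x\<in>S. \<forall>i\<in>J. x \<in> F i \<longleftrightarrow> i = j"
proof -
  have "\<exists>J\<subseteq>I. S \<subseteq> (\<Union>i\<in>J. F i) \<and> (\<forall>j\<in>J. \<exists>x\<in>S. \<forall>i\<in>J. x \<in> F i \<longleftrightarrow> i = j)"
    using assms
  proof (induction I rule: finite_psubset_induct)
    case (psubset I)
    show ?case
    proof (cases "\<exists>j\<in>I. S \<subseteq> (\<Union>i\<in>I - {j}. F i)")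
      case True
      then obtain j where "j \<in> I" and cover: "S \<subseteq> (\<Union>i\<in>I - {j}. F i)" by blast
      then have "I - {j} \<subset> I" by blast
      from psubset.IH[OF this cover] show ?thesis by (meson Diff_subset order_trans)
    next
      case False
      have "\<exists>x\<in>S. \<forall>i\<in>I. x \<in> F i \<longleftrightarrow> i = j" if j: "j \<in> I" for j
      proof -
        obtain x where x: "x \<in> S" "x \<notin> (\<Union>i\<in>I - {j}. F i)" using False j by blast
        moreover obtain i where "i \<in> I" "x \<in> F i" using x(1) psubset.prems by blast
        ultimately show ?thesis by (metis DiffI UN_I singletonD)
      qed
      with psubset.prems show ?thesis by blast
    qed
  qed
  with that show thesis by blast
qed

context group
begin

section \<open>Groups covered by two or three subgroups\<close>

lemma subgroup_mult_left_iff: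
  assumes "subgroup A G" "x \<in> A" "y \<in> carrier G"
  shows "x \<otimes> y \<in> A \<longleftrightarrow> y \<in> A"
proof
  assume "x \<otimes> y \<in> A"
  then have "inv x \<otimes> (x \<otimes> y) \<in> A"
    using assms by (meson subgroup.m_closed subgroup.m_inv_closed)
  moreover have "inv x \<otimes> (x \<otimes> y) = y"
    using assms subgroup.mem_carrier[OF assms(1,2)] by (simp add: m_assoc[symmetric])
  ultimately show "y \<in> A" by simp
qed (use assms in \<open>meson subgroup.m_closed\<close>)

lemma subgroup_mult_right_iff:
  assumes "subgroup A G" "y \<in> A" "x \<in> carrier G"
  shows "x \<otimes> y \<in> A \<longleftrightarrow> x \<in> A"
proof
  assume "x \<otimes> y \<in> A"
  then have "(x \<otimes> y) \<otimes> inv y \<in> A"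
    using assms by (meson subgroup.m_closed subgroup.m_inv_closed)
  moreover have "(x \<otimes> y) \<otimes> inv y = x"
    using assms subgroup.mem_carrier[OF assms(1,2)] by (simp add: m_assoc)
  ultimately show "x \<in> A" by simp
qed (use assms in \<open>meson subgroup.m_closed\<close>)

text \<open>As \<open>a\<close> lies only in \<open>A\<close> and \<open>b\<close> only in
  \<open>B\<close>, their product lies in neither.\<close>

lemma not_union_two_subgroups:
  assumes "subgroup A G" "subgroup B G" "carrier G \<subseteq> A \<union> B"
    and "a \<in> carrier G" "a \<notin> B" "b \<in> carrier G" "b \<notin> A"
  shows False
proof -
  have "a \<in> A" "b \<in> B" using assms by auto
  then have "a \<otimes> b \<notin> A" "a \<otimes> b \<notin> B"
    using assms subgroup_mult_left_iff subgroup_mult_right_iff by auto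
  then show False using assms by blast
qed

text \<open>For \<open>x\<close> in \<open>A\<close> and \<open>B\<close>, the product
  \<open>x \<otimes> c\<close> stays outside both, hence lies in \<open>C\<close>; cancelling
  \<open>c\<close>, itself in \<open>C\<close>, leaves \<open>x\<close> in \<open>C\<close>.\<close>

lemma three_subgroup_cover_Int_subset:
  assumes "subgroup A G" "subgroup B G" "subgroup C G" "carrier G \<subseteq> A \<union> B \<union> C"
    and "c \<in> carrier G" "c \<notin> A" "c \<notin> B"
  shows "A \<inter> B \<subseteq> C"
proof
  fix x assume x: "x \<in> A \<inter> B"
  then have xG: "x \<in> carrier G" using assms(1) subgroup.mem_carrier by fast
  have "c \<in> C" using assms by blast
  moreover have "x \<otimes> c \<notin> A" "x \<otimes> c \<notin> B"
    using x assms subgroup_mult_left_iff by auto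
  then have "x \<otimes> c \<in> C" using assms(4) xG assms(5) by blast
  ultimately show "x \<in> C" using subgroup_mult_right_iff assms(3) xG by blast
qed

text \<open>The four cosets \<open>D\<close>, \<open>D a\<close>, \<open>D b\<close>,
  \<open>D c\<close> are disjoint, because membership in \<open>A\<close> and in \<open>B\<close>
  tells them apart.\<close>

lemma three_subgroup_cover_card:
  assumes fin: "finite (carrier G)"
    and sub: "subgroup A G" "subgroup B G" "subgroup C G"
    and a: "a \<in> A" "a \<notin> B" "a \<notin> C"
    and b: "b \<in> B" "b \<notin> A" "b \<notin> C"
    and c: "c \<in> C" "c \<notin> A" "c \<notin> B"
  shows "4 * card (A \<inter> B \<inter> C) \<le> order G"
proof -
  define D where "D = A \<inter> B \<inter> C"
  have carr: "A \<subseteq> carrier G" "B \<subseteq> carrier G" "C \<subseteq> carrier G"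
    using sub subgroup.subset by auto
  then have abc: "a \<in> carrier G" "b \<in> carrier G" "c \<in> carrier G" using a b c by auto
  have D: "D \<subseteq> carrier G" and finD: "finite D"
    using carr fin by (auto simp: D_def intro: finite_subset)
  let ?sh = "\<lambda>g. (\<lambda>x. x \<otimes> g) ` D"
  have card_sh: "card (?sh g) = card D" if "g \<in> carrier G" for g
    using that D by (intro card_image inj_onI) (metis right_cancel subsetD)
  have memA: "y \<in> A \<longleftrightarrow> g \<in> A" and memB: "y \<in> B \<longleftrightarrow> g \<in> B" and memC: "y \<in> C \<longleftrightarrow> g \<in> C"
    if "y \<in> ?sh g" "g \<in> carrier G" for y g
    using that subgroup_mult_left_iff[OF sub(1)] subgroup_mult_left_iff[OF sub(2)]
      subgroup_mult_left_iff[OF sub(3)] by (auto simp: D_def)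
  have D_sub: "x \<in> A" "x \<in> B" if "x \<in> D" for x using that by (auto simp: D_def)
  have shA: "x \<in> A" "x \<notin> B" if "x \<in> ?sh a" for x using memA memB that abc(1) a by blast+
  have shB: "x \<in> B" "x \<notin> A" if "x \<in> ?sh b" for x using memA memB that abc(2) b by blast+
  have shC: "x \<notin> A" "x \<notin> B" if "x \<in> ?sh c" for x using memA memB that abc(3) c by blast+
  have disj: "D \<inter> ?sh a = {}" "(D \<union> ?sh a) \<inter> ?sh b = {}"
    "(D \<union> ?sh a \<union> ?sh b) \<inter> ?sh c = {}"
    unfolding disjoint_iff Un_iff using D_sub shA shB shC by metis+
  have "card (D \<union> ?sh a \<union> ?sh b \<union> ?sh c) = 4 * card D"
    using finD card_sh abc card_Un_disjoint[OF _ _ disj(1)] card_Un_disjoint[OF _ _ disj(2)]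
      card_Un_disjoint[OF _ _ disj(3)] by simp
  moreover have "card (D \<union> ?sh a \<union> ?sh b \<union> ?sh c) \<le> order G"
    unfolding order_def using D abc by (intro card_mono fin) auto
  ultimately show ?thesis by (simp add: D_def)
qed

subsection \<open>Fixed points of powers of an automorphism\<close>

lemma subgroup_fixed_points:
  assumes "h \<in> hom G G"
  shows "subgroup {x \<in> carrier G. h x = x} G"
proof -
  interpret h: group_hom G G h using assms by unfold_locales
  show ?thesis by unfold_locales auto
qed

lemma funpow_hom: "f \<in> hom G G \<Longrightarrow> f ^^ k \<in> hom G G"
proof (induction k)
  case 0
  show ?case by (auto simp: hom_def)
next
  case (Suc k)
  then have "f \<circ> f ^^ k \<in> hom G G" by (intro Group.hom_compose[of "f ^^ k" G G]) simp_all
  then show ?case by (simp only: funpow.simps)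
qed

text \<open>Since \<open>h\<close> fixes \<open>z\<close>, each application of \<open>h\<close>
  contributes one more factor \<open>z\<close>.\<close>

lemma funpow_eq_mult_nat_pow:
  assumes h: "h \<in> hom G G" and t: "t \<in> carrier G" and z: "z \<in> carrier G" "h z = z"
    and ht: "h t = t \<otimes> z"
  shows "(h ^^ k) t = t \<otimes> z [^] k"
proof (induction k)
  case (Suc k)
  interpret h: group_hom G G h using h by unfold_locales
  have "(h ^^ Suc k) t = h t \<otimes> z [^] k" using t z Suc by (simp add: h.hom_nat_pow)
  also have "\<dots> = t \<otimes> (z \<otimes> z [^] k)" using t z by (simp add: ht m_assoc)
  also have "z \<otimes> z [^] k = z [^] Suc k" using z(1) by (rule nat_pow_Suc2[symmetric])
  finally show ?case .
qed (use t in simp)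

text \<open>The element \<open>c \<otimes> inv b\<close> lies outside \<open>B\<close> and
  \<open>C\<close>, so \<open>h\<close> fixes it. Hence \<open>b\<close> and \<open>c\<close> are
  displaced by the same \<open>z\<close>, which invariance puts into \<open>B\<close> through
  \<open>b\<close> and into \<open>C\<close> through \<open>c\<close>.\<close>

lemma prime_dvd_card_three_cover:
  assumes p: "prime p" and h: "h \<in> hom G G" and hp: "\<And>x. x \<in> carrier G \<Longrightarrow> (h ^^ p) x = x"
    and sub: "subgroup B G" "subgroup C G"
    and inv: "h ` B \<subseteq> B" "h ` C \<subseteq> C"
    and cover: "carrier G \<subseteq> {x \<in> carrier G. h x = x} \<union> B \<union> C"
    and b: "b \<in> B" "h b \<noteq> b" "b \<notin> C"
    and c: "c \<in> C" "h c \<noteq> c" "c \<notin> B"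
  shows "p dvd card ({x \<in> carrier G. h x = x} \<inter> B \<inter> C)"
proof -
  interpret h: group_hom G G h using h by unfold_locales
  let ?A = "{x \<in> carrier G. h x = x}"
  have A: "subgroup ?A G" by (rule subgroup_fixed_points[OF h])
  have bG: "b \<in> carrier G" and cG: "c \<in> carrier G" using b c sub subgroup.mem_carrier by fast+
  have cbG: "c \<otimes> inv b \<in> carrier G" using bG cG by simp
  have cbB: "c \<otimes> inv b \<notin> B"
    using subgroup_mult_right_iff[OF sub(1) subgroup.m_inv_closed[OF sub(1) b(1)] cG] c by simp
  have cbC: "c \<otimes> inv b \<notin> C"
  proof
    assume "c \<otimes> inv b \<in> C"
    then have "inv b \<in> C" using subgroup_mult_left_iff[OF sub(2) c(1)] bG by simp
    then have "inv (inv b) \<in> C" by (rule subgroup.m_inv_closed[OF sub(2)])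
    then show False using b bG by simp
  qed
  have cb: "c \<otimes> inv b \<in> ?A" using cover cbG cbB cbC by blast
  define z where "z = inv b \<otimes> h b"
  have zG: "z \<in> carrier G" using bG by (simp add: z_def)
  have zB: "z \<in> B"
    unfolding z_def using b(1) inv(1)
    by (intro subgroup.m_closed[OF sub(1)] subgroup.m_inv_closed[OF sub(1)]) auto
  have hc: "h c = c \<otimes> z"
  proof -
    have "h c = h ((c \<otimes> inv b) \<otimes> b)" using bG cG by (simp add: m_assoc del: h.hom_mult h.hom_inv)
    also have "\<dots> = h (c \<otimes> inv b) \<otimes> h b" using bG cG by (intro h.hom_mult) auto
    also have "h (c \<otimes> inv b) = c \<otimes> inv b" using cb by blast
    finally show ?thesis using bG cG by (simp add: z_def m_assoc)
  qed
  then have zC: "z \<in> C"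
    using subgroup_mult_left_iff[OF sub(2) c(1) zG] inv(2) c(1) by auto
  \<comment> \<open>The element \<open>c \<otimes> inv b\<close> outside \<open>B\<close> and
    \<open>C\<close> forces \<open>B \<inter> C\<close> into the fixed subgroup.\<close>
  have zA: "h z = z"
    using three_subgroup_cover_Int_subset[OF sub A _ cbG cbB cbC] zB zC cover by blast
  have hb: "h b = b \<otimes> z" using bG by (simp add: z_def m_assoc[symmetric])
  have "b \<otimes> z [^] p = b"
    using funpow_eq_mult_nat_pow[OF h bG zG zA hb, of p] hp[OF bG] by simp
  then have "z [^] p = \<one>" using bG zG by simp
  then have "ord z dvd p" using zG pow_eq_id by blast
  moreover have "z \<noteq> \<one>" using hb b bG by auto
  then have "ord z \<noteq> 1" using zG ord_eq_1 by blast
  ultimately have ord: "ord z = p" using p by (metis prime_nat_iff)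
  let ?D = "?A \<inter> B \<inter> C"
  have D: "subgroup ?D G" using A sub by (intro subgroups_Inter_pair)
  interpret D: group "G\<lparr>carrier := ?D\<rparr>" using D by (rule subgroup_imp_group)
  \<comment> \<open>Lagrange's theorem, applied inside \<open>?D\<close> as a group of its
    own.\<close>
  have "z [^] card ?D = \<one>"
    using D.pow_order_eq_1[of z] zA zB zC zG by (simp add: order_def flip: nat_pow_consistent)
  then show ?thesis using ord pow_eq_id[OF zG] by blast
qed

end

subsection \<open>Divisibility by several primes\<close>

lemma prod_primes_dvd:
  fixes m :: nat
  assumes "finite A" "\<And>p. p \<in> A \<Longrightarrow> prime p" "\<And>p. p \<in> A \<Longrightarrow> p dvd m"
  shows "\<Prod>A dvd m"
  using assms
proof (induction A rule: finite_induct)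
  case (insert p A)
  have "coprime p (\<Prod>A)"
    using insert by (intro prod_coprime_right) (metis insertCI primes_coprime)
  then show ?case using insert by (simp add: divides_mult)
qed simp

text \<open>If \<open>q\<close> did not divide \<open>m\<close>, it would divide the cofactor of
  \<open>m\<close> in \<open>n\<close>. Used for a point moved by \<open>f ^^ (n div q)\<close>,
  with \<open>m\<close> its cycle length.\<close>

lemma prime_dvd_of_not_dvd_div:
  fixes m n q :: nat
  assumes "prime q" "q dvd n" "m dvd n" "\<not> m dvd n div q"
  shows "q dvd m"
proof (rule ccontr)
  assume "\<not> q dvd m"
  obtain c where c: "n = m * c" using assms(3) by blast
  then have "q dvd c" using assms \<open>\<not> q dvd m\<close> prime_dvd_multD by blast
  then have "n div q = m * (c div q)" using c by (simp add: div_mult_swap)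
  then show False using assms(4) by simp
qed

text \<open>Any prime divisor of the cofactor of \<open>m\<close> in \<open>n\<close> serves as
  \<open>p\<close>.\<close>

lemma proper_dvd_imp_dvd_div_prime:
  fixes m n :: nat
  assumes "m dvd n" "m \<noteq> n" "n > 0"
  obtains p where "p \<in> prime_factors n" "m dvd n div p"
proof -
  obtain c where c: "n = m * c" using assms(1) by blast
  then obtain p d where p: "prime p" "c = p * d"
    using assms(2) prime_factor_nat[of c] by (metis dvdE mult.right_neutral)
  then have "n div p = m * d" using c prime_gt_0_nat[of p] by simp
  moreover have "p \<in> prime_factors n" using p c assms(3) by (auto simp: prime_factors_dvd)
  ultimately show thesis using that by simp
qed

text \<open>In increasing order the primes are at least 2, 3, 5, and without 2 at least 3, 5, 7,
  because 4 and 6 are composite.\<close>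

lemma three_primes_prod:
  fixes p q r :: nat
  assumes "prime p" "prime q" "prime r" "p \<noteq> q" "p \<noteq> r" "q \<noteq> r"
  shows "30 \<le> p * q * r" and "2 \<notin> {p, q, r} \<Longrightarrow> 105 \<le> p * q * r"
proof -
  have sorted: "30 \<le> a * b * c \<and> (a \<noteq> 2 \<longrightarrow> 105 \<le> a * b * c)"
    if "prime a" "prime b" "prime c" "a < b" "b < c" for a b c :: nat
  proof -
    have ge: "2 \<le> a" using prime_ge_2_nat that by blast
    have not: "\<not> prime (4::nat)" "\<not> prime (6::nat)"
      by (simp_all add: prime_nat_iff') (auto intro: bexI[of _ 2])
    have 1: "5 \<le> c" using ge that not by (cases "c = 4") auto
    have 2: "3 \<le> a \<and> 5 \<le> b \<and> 7 \<le> c" if "a \<noteq> 2"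
    proof -
      have "3 \<le> a" using ge that by simp
      moreover from this have "5 \<le> b"
        using \<open>prime b\<close> \<open>a < b\<close> not by (cases "b = 4") auto
      moreover from this have "7 \<le> c"
        using \<open>prime c\<close> \<open>b < c\<close> not by (cases "c = 6") auto
      ultimately show ?thesis by blast
    qed
    have "2 * 3 * 5 \<le> a * b * c" using ge 1 that by (intro mult_le_mono) auto
    moreover have "3 * 5 * 7 \<le> a * b * c" if "a \<noteq> 2" using 2[OF that] by (intro mult_le_mono) auto
    ultimately show ?thesis by simp
  qed
  have "30 \<le> p * q * r \<and> (2 \<notin> {p, q, r} \<longrightarrow> 105 \<le> p * q * r)"
  proof -
    consider "p < q" "q < r" | "p < r" "r < q" | "q < p" "p < r" | "q < r" "r < p"
      | "r < p" "p < q" | "r < q" "q < p"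
      using assms by linarith
    then show ?thesis
      using sorted[of p q r] sorted[of p r q] sorted[of q p r] sorted[of q r p] sorted[of r p q]
        sorted[of r q p] assms(1-3)
      by cases (simp_all add: mult.commute mult.left_commute)
  qed
  then show "30 \<le> p * q * r" and "2 \<notin> {p, q, r} \<Longrightarrow> 105 \<le> p * q * r" by auto
qed

lemma prod_three_primes_le:
  fixes A :: "nat set"
  assumes "finite A" "\<And>p. p \<in> A \<Longrightarrow> prime p" "3 \<le> card A"
  shows "30 \<le> \<Prod>A" and "2 \<notin> A \<Longrightarrow> 105 \<le> \<Prod>A"
proof -
  obtain T where T: "T \<subseteq> A" "card T = 3" "finite T"
    using assms(3) by (metis obtain_subset_with_card_n)
  then obtain p q r where pqr: "T = {p, q, r}" "p \<noteq> q" "p \<noteq> r" "q \<noteq> r"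
    by (auto simp: card_3_iff)
  have "\<Prod>T dvd \<Prod>A" using T assms(1) by (simp add: prod_dvd_prod_subset)
  moreover have "0 < \<Prod>A" using assms(2) prime_gt_0_nat by (simp add: prod_pos)
  ultimately have "p * q * r \<le> \<Prod>A" using pqr dvd_imp_le by (simp add: ac_simps)
  then show "30 \<le> \<Prod>A" and "2 \<notin> A \<Longrightarrow> 105 \<le> \<Prod>A"
    using three_primes_prod[of p q r] pqr T(1) assms(2) by fastforce+
qed

subsection \<open>The lower bound\<close>

lemma (in group) non_RCC_automorphism_card:
  assumes f: "f \<in> auto G" and fin: "finite (carrier G)"
    and non: "\<not> regular_cycle_condition (carrier G) f"
  shows "120 \<le> order G"
proof -
  let ?S = "carrier G"
  define n where "n = group.ord (BijGroup ?S) f"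
  define F where "F p = {x \<in> ?S. (f ^^ (n div p)) x = x}" for p
  define orb where "orb = Orbits.orbit f"
  have bij: "f \<in> Bij ?S" and hom: "f \<in> hom G G" using f by (auto simp: auto_def)
  have pow_closed: "(f ^^ k) x \<in> ?S" if "x \<in> ?S" for k x
    using funpow_hom[OF hom] that by (rule hom_in_carrier)
  have n_pos: "0 < n" unfolding n_def by (rule ord_BijGroup_pos[OF bij fin])
  have n_dvd: "n dvd k \<longleftrightarrow> (\<forall>x\<in>?S. (f ^^ k) x = x)" for k
    unfolding n_def by (rule ord_BijGroup_dvd_iff[OF bij])
  have orb_dvd: "card (orb x) dvd k \<longleftrightarrow> (f ^^ k) x = x" if "x \<in> ?S" for x k
    unfolding orb_def by (rule card_orbit_dvd_iff[OF self_in_orbit_Bij[OF bij fin that]])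
  have orb_dvd_n: "card (orb x) dvd n" if "x \<in> ?S" for x
    using orb_dvd[OF that] n_dvd[of n] that by simp
  have orb_sub: "orb x \<subseteq> ?S" if "x \<in> ?S" for x
    using pow_closed[OF that] by (auto simp: orb_def orbit_altdef)
  have F_sub: "subgroup (F p) G" for p
    unfolding F_def by (rule subgroup_fixed_points[OF funpow_hom[OF hom]])
  have F_pow: "(f ^^ k) x \<in> F p" if "x \<in> F p" for k p x
  proof -
    have "(f ^^ (n div p)) ((f ^^ k) x) = (f ^^ k) ((f ^^ (n div p)) x)"
      by (metis add.commute comp_apply funpow_add)
    then show ?thesis using that pow_closed by (simp add: F_def)
  qed
  have F_orb: "orb x \<subseteq> F p" if "x \<in> F p" for p x
    using F_pow[OF that] by (auto simp: orb_def orbit_altdef)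
  have "?S \<subseteq> (\<Union>p\<in>prime_factors n. F p)"
  proof
    fix x assume x: "x \<in> ?S"
    then have "card (orb x) \<noteq> n"
      using non by (auto simp: regular_cycle_condition_def orb_def n_def)
    then obtain p where "p \<in> prime_factors n" "card (orb x) dvd n div p"
      using proper_dvd_imp_dvd_div_prime[OF orb_dvd_n[OF x]] n_pos by blast
    then show "x \<in> (\<Union>p\<in>prime_factors n. F p)" using orb_dvd[OF x] x by (auto simp: F_def)
  qed
  then obtain J where J: "J \<subseteq> prime_factors n" "?S \<subseteq> (\<Union>p\<in>J. F p)"
    and irr: "\<And>j. j \<in> J \<Longrightarrow> \<exists>x\<in>?S. \<forall>i\<in>J. x \<in> F i \<longleftrightarrow> i = j"
    using irredundant_subcover[of "prime_factors n" ?S F thesis] by simp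
  \<comment> \<open>\<open>w j\<close> witnesses irredundance: among the subgroups indexed by
    \<open>J\<close> it lies in \<open>F j\<close> only.\<close>
  define w where "w j = (SOME x. x \<in> ?S \<and> (\<forall>i\<in>J. x \<in> F i \<longleftrightarrow> i = j))" for j
  have w_all: "w j \<in> ?S \<and> (\<forall>i\<in>J. w j \<in> F i \<longleftrightarrow> i = j)" if "j \<in> J" for j
    unfolding w_def by (rule someI_ex) (use irr[OF that] in blast)
  then have w: "w j \<in> ?S" if "j \<in> J" for j using that by blast
  have wF: "w j \<in> F i \<longleftrightarrow> i = j" if "i \<in> J" "j \<in> J" for i j using w_all that by blast
  have finJ: "finite J" using J(1) finite_subset by blast
  have prime: "prime p" and dvd: "p dvd n" if "p \<in> J" for p using that J(1) by auto
  have F_proper: "\<not> ?S \<subseteq> F p" if "p \<in> J" for p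
  proof
    \<comment> \<open>Then \<open>f ^^ (n div p)\<close> is trivial on the group, so
      \<open>n\<close> divides a smaller number, which must be 0.\<close>
    assume "?S \<subseteq> F p"
    then have "n dvd n div p" by (subst n_dvd) (auto simp: F_def)
    moreover have "n div p < n" using n_pos prime_gt_1_nat[OF prime[OF that]] by simp
    ultimately have "n div p = 0" by (meson gr0I nat_dvd_not_less)
    then show False using n_pos dvd[OF that] by (simp add: dvd_div_eq_0_iff)
  qed
  show ?thesis
  proof (cases "4 \<le> card J")
    case True
    have orb_ge: "\<Prod>(J - {j}) \<le> card (orb (w j))" if j: "j \<in> J" for j
    proof (rule dvd_imp_le)
      show "\<Prod>(J - {j}) dvd card (orb (w j))"
      proof (rule prod_primes_dvd)
        fix q assume q: "q \<in> J - {j}"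
        then have "w j \<notin> F q" using wF[of q j] j by auto
        then have "\<not> card (orb (w j)) dvd n div q"
          using orb_dvd[OF w[OF j]] w[OF j] by (simp add: F_def)
        then show "q dvd card (orb (w j))"
          using prime_dvd_of_not_dvd_div[of q n] prime dvd orb_dvd_n[OF w[OF j]] q by blast
      qed (use finJ prime in auto)
      show "0 < card (orb (w j))"
        using orb_dvd_n[OF w[OF j]] n_pos dvd_pos_nat by blast
    qed
    have "J \<noteq> {}" using True by auto
    \<comment> \<open>If 2 is in \<open>J\<close>, then \<open>i\<close> is 2; what remains consists
      of odd primes, which gives the bound 105 for one cycle.\<close>
    then obtain i where i: "i \<in> J" "2 \<notin> J - {i}" by (cases "2 \<in> J") blast+
    have card: "3 \<le> card (J - {j})" if "j \<in> J" for j using True finJ that by simp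
    then have "card (J - {i}) > 0" using i by fastforce
    then obtain j where j: "j \<in> J" "j \<noteq> i" by (auto simp: card_gt_0_iff)
    have "105 \<le> card (orb (w i))"
      using prod_three_primes_le(2)[of "J - {i}"] card i finJ prime orb_ge[of i] by fastforce
    moreover have "30 \<le> card (orb (w j))"
      using prod_three_primes_le(1)[of "J - {j}"] card j finJ prime orb_ge[of j] by fastforce
    \<comment> \<open>The cycle of \<open>w i\<close> stays inside \<open>F i\<close>, while
      \<open>w j\<close> is outside it. Two disjoint cycles give 105 + 30 > 120 elements.\<close>
    moreover have "orb (w i) \<inter> orb (w j) = {}"
    proof (rule ccontr)
      assume "orb (w i) \<inter> orb (w j) \<noteq> {}"
      then obtain y where y: "y \<in> orb (w i)" "y \<in> orb (w j)" by blast
      have "w j \<in> orb y"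
        using y(2) self_in_orbit_Bij[OF bij fin w[OF j(1)]] unfolding orb_def by (rule orbit_swap[rotated])
      moreover have "y \<in> F i" using y(1) F_orb[of "w i" i] wF i by blast
      ultimately have "w j \<in> F i" using F_orb by blast
      then show False using wF i j by blast
    qed
    then have "card (orb (w i)) + card (orb (w j)) \<le> order G"
      unfolding order_def using orb_sub w i j fin
      by (subst card_Un_disjoint[symmetric]) (auto intro: finite_subset intro!: card_mono)
    ultimately show ?thesis by linarith
  next
    case False
    then consider "card J = 0" | "card J = 1" | "card J = 2" | "card J = 3" by linarith
    then show ?thesis
    proof cases
      case 1
      then show ?thesis using finJ J(2) by auto
    next
      case 2
      then show ?thesis using F_proper J(2) by (auto simp: card_1_singleton_iff)
    next
      case 3
      then obtain p q where "J = {p, q}" "p \<noteq> q" by (auto simp: card_2_iff)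
      then show ?thesis
        using not_union_two_subgroups[OF F_sub[of p] F_sub[of q], of "w p" "w q"] J(2) w wF by auto
    next
      case 4
      then obtain p q r where pqr: "J = {p, q, r}" "p \<noteq> q" "p \<noteq> r" "q \<noteq> r"
        by (auto simp: card_3_iff)
      \<comment> \<open>Stated for an arbitrary ordering of \<open>J\<close>, so that each of the
        three primes can take the role of \<open>a\<close>.\<close>
      have dvd_card: "a dvd card (F a \<inter> F b \<inter> F c)"
        if J_eq: "J = {a, b, c}" and ne: "a \<noteq> b" "a \<noteq> c" "b \<noteq> c" for a b c
      proof -
        let ?h = "f ^^ (n div a)"
        have J_mem: "a \<in> J" "b \<in> J" "c \<in> J" using J_eq by auto
        have F_eq: "{x \<in> ?S. ?h x = x} = F a" by (simp add: F_def)
        have "(?h ^^ a) x = x" if "x \<in> ?S" for x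
          using n_dvd[of n] dvd[OF J_mem(1)] that by (simp add: funpow_mult)
        moreover have "?h ` F i \<subseteq> F i" for i using F_pow by blast
        moreover have "?S \<subseteq> {x \<in> ?S. ?h x = x} \<union> F b \<union> F c"
          using J(2) unfolding F_eq J_eq by auto
        moreover have "w b \<in> F b" "w b \<notin> F c" "w c \<in> F c" "w c \<notin> F b"
          using wF J_mem ne by auto
        moreover have "w b \<notin> F a" "w c \<notin> F a" using wF J_mem ne by auto
        then have "?h (w b) \<noteq> w b" "?h (w c) \<noteq> w c"
          using w J_mem unfolding F_eq[symmetric] by auto
        ultimately have "a dvd card ({x \<in> ?S. ?h x = x} \<inter> F b \<inter> F c)"
          using prime[OF J_mem(1)] by (intro prime_dvd_card_three_cover[OF _ funpow_hom[OF hom] _ F_sub F_sub])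
        then show ?thesis unfolding F_eq .
      qed
      let ?D = "F p \<inter> F q \<inter> F r"
      have "\<Prod>J dvd card ?D"
        using dvd_card[of p q r] dvd_card[of q p r] dvd_card[of r p q] pqr prime
        by (intro prod_primes_dvd finJ) (auto simp: Int_ac insert_commute)
      then have "p * q * r dvd card ?D" using pqr by (simp add: mult.assoc)
      moreover have "\<one> \<in> ?D" using F_sub subgroup.one_closed by blast
      then have "0 < card ?D" using fin by (auto simp: card_gt_0_iff F_def)
      ultimately have "p * q * r \<le> card ?D" by (rule dvd_imp_le)
      moreover have "30 \<le> p * q * r" using pqr prime by (intro three_primes_prod(1)) auto
      moreover have "4 * card ?D \<le> order G"
      proof (rule three_subgroup_cover_card[OF fin F_sub F_sub F_sub])
        show "w p \<in> F p" "w p \<notin> F q" "w p \<notin> F r" "w q \<in> F q" "w q \<notin> F p" "w q \<notin> F r"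
          "w r \<in> F r" "w r \<notin> F p" "w r \<notin> F q"
          using wF pqr by auto
      qed
      ultimately show ?thesis by linarith
    qed
  qed
qed

subsection \<open>Examples\<close>

text \<open>Members of \<open>auto G\<close> are \<open>undefined\<close> off the carrier, so the
  automorphism used is the restriction of \<open>f\<close>; on the carrier both have the same
  iterates.\<close>

lemma finite_non_RCC_groupI:
  assumes "group G" "finite (carrier G)" and hom: "f \<in> hom G G"
    and bij: "bij_betw f (carrier G) (carrier G)"
    and returns: "\<And>x. x \<in> carrier G \<Longrightarrow> \<exists>k. (f ^^ k) x = x \<and> (\<exists>y\<in>carrier G. (f ^^ k) y \<noteq> y)"
  shows "finite_non_RCC_group G"
proof -
  let ?S = "carrier G"
  let ?g = "restrict f ?S"
  have closed: "(f ^^ k) x \<in> ?S" if "x \<in> ?S" for k x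
    using that hom by (induction k) (auto simp: hom_def)
  have pow: "(?g ^^ k) x = (f ^^ k) x" if "x \<in> ?S" for k x
    by (induction k) (simp_all add: closed[OF that])
  have "?g \<in> hom G G" by (rule group.hom_restrict[OF \<open>group G\<close> hom]) simp
  moreover have Bij: "?g \<in> Bij ?S" using bij by (auto simp: Bij_def cong: bij_betw_cong)
  ultimately have "?g \<in> auto G" by (simp add: auto_def)
  moreover have "\<not> regular_cycle_condition ?S ?g"
    using returns by (auto simp: regular_cycle_condition_iff[OF Bij assms(2)] pow)
  ultimately show ?thesis
    using assms(1,2) by (auto simp: finite_non_RCC_group_def finite_RCC_group_def)
qed

section \<open>Invariance under isomorphism\<close>

lemma finite_non_RCC_groupE:
  assumes "finite_non_RCC_group G"
  obtains f where "f \<in> auto G"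
    "\<And>x. x \<in> carrier G \<Longrightarrow> \<exists>k. (f ^^ k) x = x \<and> (\<exists>y\<in>carrier G. (f ^^ k) y \<noteq> y)"
proof -
  obtain f where f: "f \<in> auto G" "\<not> regular_cycle_condition (carrier G) f"
    using assms by (auto simp: finite_non_RCC_group_def finite_RCC_group_def)
  then have "f \<in> Bij (carrier G)" by (simp add: auto_def)
  with f that show thesis
    using assms by (auto simp: regular_cycle_condition_iff finite_non_RCC_group_def)
qed

text \<open>Conjugating \<open>f\<close> by \<open>h\<close> carries the fixed points of each power
  of \<open>f\<close> to those of the same power of \<open>g\<close>.\<close>

lemma finite_non_RCC_group_iso:
  assumes G: "finite_non_RCC_group G" and H: "group H" and h: "h \<in> iso G H"
  shows "finite_non_RCC_group H"
proof -
  interpret G: group G using G by (simp add: finite_non_RCC_group_def)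
  interpret H: group H by (rule H)
  obtain f where f: "f \<in> auto G"
    and returns: "\<And>x. x \<in> carrier G \<Longrightarrow> \<exists>k. (f ^^ k) x = x \<and> (\<exists>y\<in>carrier G. (f ^^ k) y \<noteq> y)"
    by (rule finite_non_RCC_groupE[OF G]) blast
  define h' where "h' = inv_into (carrier G) h"
  define g where "g = h \<circ> f \<circ> h'"
  have h_hom: "h \<in> hom G H" and h_bij: "bij_betw h (carrier G) (carrier H)"
    using h by (auto simp: iso_def)
  have h'_iso: "h' \<in> iso H G" unfolding h'_def by (rule G.iso_set_sym[OF h])
  have f_iso: "f \<in> hom G G" "bij_betw f (carrier G) (carrier G)"
    using f by (auto simp: auto_def Bij_def)
  have h'h: "h' (h x) = x" if "x \<in> carrier G" for x
    using that h_bij unfolding h'_def by (simp add: bij_betw_inv_into_left)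
  have closed: "(f ^^ k) x \<in> carrier G" if "x \<in> carrier G" for k x
    using hom_in_carrier[OF G.funpow_hom[OF f_iso(1)] that] .
  have pow: "(g ^^ k) (h x) = h ((f ^^ k) x)" if "x \<in> carrier G" for k x
    by (induction k) (simp_all add: g_def h'h closed[OF that])
  show ?thesis
  proof (rule finite_non_RCC_groupI[OF H])
    show "finite (carrier H)"
      using G h_bij bij_betw_finite by (auto simp: finite_non_RCC_group_def)
    show "g \<in> hom H H"
      unfolding g_def using h'_iso f_iso(1) h_hom
      by (intro Group.hom_compose[of _ H G]) (auto simp: iso_def intro: Group.hom_compose)
    show "bij_betw g (carrier H) (carrier H)"
      unfolding g_def using h'_iso f_iso(2) h_bij
      by (intro bij_betw_trans[of _ _ "carrier G"]) (auto simp: iso_def)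
    fix y assume "y \<in> carrier H"
    then obtain x where x: "x \<in> carrier G" "y = h x"
      using h_bij by (auto simp: bij_betw_def)
    obtain k z where k: "(f ^^ k) x = x" "z \<in> carrier G" "(f ^^ k) z \<noteq> z"
      using returns[OF x(1)] by blast
    have "(g ^^ k) y = y" using k(1) x by (simp add: pow)
    moreover have "(g ^^ k) (h z) \<noteq> h z"
      using k(2,3) closed[OF k(2), of k] h_bij by (auto simp: pow bij_betw_def dest: inj_onD)
    moreover have "h z \<in> carrier H" using k(2) h_bij by (auto simp: bij_betw_def)
    ultimately show "\<exists>k. (g ^^ k) y = y \<and> (\<exists>y\<in>carrier H. (g ^^ k) y \<noteq> y)" by blast
  qed
qed

text \<open>The dihedral group of order \<open>2 * n\<close>. The pair \<open>(s, a)\<close> encodes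
  a reflection to the power \<open>s\<close> followed by a rotation to the power \<open>a\<close>;
  moving a rotation past the reflection inverts it.\<close>

definition dihedral_group :: "nat \<Rightarrow> (bool \<times> int) monoid" where
  "dihedral_group n = \<lparr>carrier = UNIV \<times> {0..<int n},
     monoid.mult = \<lambda>(s, a) (t, b). (s \<noteq> t, (b + (if t then - a else a)) mod int n),
     one = (False, 0)\<rparr>"

lemma group_dihedral_group:
  assumes "0 < n"
  shows "group (dihedral_group n)"
proof (rule groupI)
  fix x assume x: "x \<in> carrier (dihedral_group n)"
  obtain s a where sa: "x = (s, a)" by (cases x)
  let ?y = "(s, if s then a else (- a) mod int n)"
  have "?y \<in> carrier (dihedral_group n)"
    using x sa assms by (auto simp: dihedral_group_def)
  moreover have "?y \<otimes>\<^bsub>dihedral_group n\<^esub> x = \<one>\<^bsub>dihedral_group n\<^esub>"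
    by (auto simp: sa dihedral_group_def mod_simps)
  ultimately show "\<exists>y\<in>carrier (dihedral_group n). y \<otimes>\<^bsub>dihedral_group n\<^esub> x = \<one>\<^bsub>dihedral_group n\<^esub>"
    by blast
qed (use assms in \<open>auto simp: dihedral_group_def mod_simps algebra_simps split: prod.splits\<close>)

text \<open>The case \<open>m = 1\<close> attains order 120. For \<open>m = 0\<close> the last
  factor is the infinite group of all integers.\<close>

definition non_RCC_example :: "nat \<Rightarrow> ((bool \<times> int) \<times> (bool \<times> int) \<times> int \<times> int) monoid" where
  "non_RCC_example m =
     dihedral_group 3 \<times>\<times> dihedral_group 5 \<times>\<times> integer_mod_group 2 \<times>\<times> integer_mod_group m"

text \<open>
  On the two dihedral factors this is conjugation by a rotation; it fixes exactly the elements
  with \<open>s\<close> false, respectively \<open>t\<close> false. On the central factor of order 2 the fixed elements are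
  those with \<open>s = t\<close>. These three subgroups of index 2 cover the group.
\<close>

definition non_RCC_automorphism ::
    "(bool \<times> int) \<times> (bool \<times> int) \<times> int \<times> int \<Rightarrow> (bool \<times> int) \<times> (bool \<times> int) \<times> int \<times> int" where
  "non_RCC_automorphism = (\<lambda>((s, a), (t, b), c, d).
     ((s, (a + of_bool s) mod 3), (t, (b + of_bool t) mod 5), (c + of_bool (s \<noteq> t)) mod 2, d))"

lemma carrier_non_RCC_example:
  "carrier (non_RCC_example m) = (UNIV \<times> {0..<3}) \<times> (UNIV \<times> {0..<5}) \<times> {0..<2} \<times> carrier (integer_mod_group m)"
  by (simp add: non_RCC_example_def dihedral_group_def carrier_integer_mod_group)

lemma group_non_RCC_example: "group (non_RCC_example m)"
  unfolding non_RCC_example_def by (intro DirProd_group group_dihedral_group group_integer_mod_group) auto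

lemma order_non_RCC_example: "0 < m \<Longrightarrow> order (non_RCC_example m) = 120 * m"
  by (simp add: order_def carrier_non_RCC_example card_cartesian_product carrier_integer_mod_group)

text \<open>The flags multiply by exclusive or, so \<open>s \<noteq> t\<close> is additive modulo 2;
  this makes the central coordinate compatible with products.\<close>

lemma hom_non_RCC_automorphism:
  "non_RCC_automorphism \<in> hom (non_RCC_example m) (non_RCC_example m)"
proof (rule homI)
  fix x y :: "(bool \<times> int) \<times> (bool \<times> int) \<times> int \<times> int"
  obtain s a t b c d where x: "x = ((s, a), (t, b), c, d)" by (metis surj_pair)
  obtain s' a' t' b' c' d' where y: "y = ((s', a'), (t', b'), c', d')" by (metis surj_pair)
  show "non_RCC_automorphism (x \<otimes>\<^bsub>non_RCC_example m\<^esub> y) =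
      non_RCC_automorphism x \<otimes>\<^bsub>non_RCC_example m\<^esub> non_RCC_automorphism y"
    by (cases s; cases s'; cases t; cases t')
      (simp_all add: x y non_RCC_automorphism_def non_RCC_example_def dihedral_group_def
        mod_simps algebra_simps, presburger+)
qed (auto simp: non_RCC_automorphism_def carrier_non_RCC_example)

text \<open>The flags never change, so each step adds a constant. The ranges of \<open>a\<close>,
  \<open>b\<close>, \<open>c\<close> settle \<open>k = 0\<close>, where nothing has been reduced
  yet.\<close>

lemma funpow_non_RCC_automorphism:
  assumes "a \<in> {0..<3}" "b \<in> {0..<5}" "c \<in> {0..<2}"
  shows "(non_RCC_automorphism ^^ k) ((s, a), (t, b), c, d) =
    ((s, (a + int k * of_bool s) mod 3), (t, (b + int k * of_bool t) mod 5),
     (c + int k * of_bool (s \<noteq> t)) mod 2, d)"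
proof (induction k)
  case 0
  show ?case using assms by simp
next
  case (Suc k)
  then show ?case by (simp add: non_RCC_automorphism_def mod_simps algebra_simps)
qed

lemma finite_non_RCC_group_example:
  assumes "0 < m"
  shows "finite_non_RCC_group (non_RCC_example m)"
proof (rule finite_non_RCC_groupI[OF group_non_RCC_example _ hom_non_RCC_automorphism])
  let ?S = "carrier (non_RCC_example m)" and ?f = non_RCC_automorphism
  show "finite ?S" using assms by (simp add: carrier_non_RCC_example carrier_integer_mod_group)
  \<comment> \<open>30 is a common multiple of the moduli 3, 5 and 2; injectivity follows because
    \<open>?f ^^ 29\<close> undoes \<open>?f\<close>.\<close>
  have "(?f ^^ 30) x = x" if "x \<in> ?S" for x
    using that by (auto simp: carrier_non_RCC_example funpow_non_RCC_automorphism) presburger+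
  moreover have "?f ` ?S \<subseteq> ?S"
    using hom_in_carrier[OF hom_non_RCC_automorphism] by blast
  ultimately have "inj_on ?f ?S"
    by (intro inj_onI) (metis Suc_numeral comp_apply funpow_Suc_right numeral_eq_Suc)
  then show "bij_betw ?f ?S ?S"
    using \<open>?f ` ?S \<subseteq> ?S\<close> \<open>finite ?S\<close> by (simp add: bij_betw_def endo_inj_surj)
  fix x assume "x \<in> ?S"
  then obtain s a t b c d where x: "x = ((s, a), (t, b), c, d)"
    and abcd: "a \<in> {0..<3}" "b \<in> {0..<5}" "c \<in> {0..<2}" "d \<in> carrier (integer_mod_group m)"
    by (auto simp: carrier_non_RCC_example)
  \<comment> \<open>The exponents are 30/3, 30/5 and 30/2: each kills the shifts for the other two
    primes, and \<open>x\<close> has no shift for the remaining one. The flags of \<open>y\<close>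
    give it precisely that shift.\<close>
  define k :: nat where "k = (if \<not> s then 10 else if \<not> t then 6 else 15)"
  define y :: "(bool \<times> int) \<times> (bool \<times> int) \<times> int \<times> int"
    where "y = ((True, 0), (s \<and> \<not> t, 0), 0, 0)"
  have "(?f ^^ k) x = x"
    using abcd by (auto simp: x k_def funpow_non_RCC_automorphism) presburger+
  moreover have "(?f ^^ k) y \<noteq> y"
    by (auto simp: y_def k_def funpow_non_RCC_automorphism)
  moreover have "y \<in> ?S" by (simp add: y_def carrier_non_RCC_example)
  ultimately show "\<exists>k. (?f ^^ k) x = x \<and> (\<exists>y\<in>?S. (?f ^^ k) y \<noteq> y)" by blast
qed

text \<open>A copy of the example on natural numbers, matching the type \<open>nat monoid\<close> in
  the existence claims.\<close>

definition non_RCC_nat :: "nat \<Rightarrow> nat monoid" where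
  "non_RCC_nat m = image_group to_nat (non_RCC_example m)"

lemma non_RCC_nat:
  assumes "0 < m"
  shows "finite_non_RCC_group (non_RCC_nat m)" and "order (non_RCC_nat m) = 120 * m"
proof -
  interpret group "non_RCC_example m" by (rule group_non_RCC_example)
  have inj: "inj_on to_nat (carrier (non_RCC_example m))" by (simp add: inj_on_subset[OF inj_to_nat])
  have iso: "to_nat \<in> iso (non_RCC_example m) (non_RCC_nat m)"
    unfolding non_RCC_nat_def by (rule inj_imp_image_group_iso[OF inj])
  have "group (non_RCC_nat m)"
    unfolding non_RCC_nat_def by (rule inj_imp_image_group_is_group[OF inj])
  then show "finite_non_RCC_group (non_RCC_nat m)"
    by (rule finite_non_RCC_group_iso[OF finite_non_RCC_group_example[OF assms] _ iso])
  show "order (non_RCC_nat m) = 120 * m"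
    using order_non_RCC_example[OF assms] iso_same_card[OF is_isoI[OF iso]] by (simp add: order_def)
qed

theorem theorem4p4:
  shows "(\<exists>\<G> :: nat monoid set. infinite \<G> \<and>
             (\<forall>G\<in>\<G>. finite_non_RCC_group G) \<and>
             pairwise (\<lambda>G H. \<not> G \<cong> H) \<G>) \<and>
         (\<exists>G :: nat monoid. finite_non_RCC_group G \<and> order G = 120) \<and>
         (\<forall>G :: 'a monoid. finite_non_RCC_group G \<longrightarrow> 120 \<le> order G)"
proof (intro conjI allI impI)
  let ?\<G> = "non_RCC_nat ` {0<..}"
  \<comment> \<open>The order recovers \<open>m\<close>. This makes the family infinite and also
    separates isomorphism classes.\<close>
  have inj: "m = m'" if "0 < m" "0 < m'" "order (non_RCC_nat m) = order (non_RCC_nat m')" for m m'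
    using that by (simp add: non_RCC_nat(2))
  have "inj_on non_RCC_nat {0<..}" by (rule inj_onI) (use inj in auto)
  then have "infinite ?\<G>" by (simp add: finite_image_iff infinite_Ioi)
  moreover have "\<forall>G\<in>?\<G>. finite_non_RCC_group G" using non_RCC_nat(1) by auto
  moreover have "pairwise (\<lambda>G H. \<not> G \<cong> H) ?\<G>"
    using inj by (auto simp: pairwise_def order_def dest!: iso_same_card)
  ultimately show "\<exists>\<G> :: nat monoid set. infinite \<G> \<and> (\<forall>G\<in>\<G>. finite_non_RCC_group G) \<and>
      pairwise (\<lambda>G H. \<not> G \<cong> H) \<G>" by blast
  show "\<exists>G :: nat monoid. finite_non_RCC_group G \<and> order G = 120"
    using non_RCC_nat[of 1] by auto
  fix G :: "'a monoid" assume G: "finite_non_RCC_group G"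
  then obtain f where "f \<in> auto G" "\<not> regular_cycle_condition (carrier G) f"
    by (auto simp: finite_non_RCC_group_def finite_RCC_group_def)
  then show "120 \<le> order G"
    using G group.non_RCC_automorphism_card by (auto simp: finite_non_RCC_group_def)
qed

end
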